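(* Let $S\subset E^3$ be a regular (smooth, immersed) surface of non-zero Gaussian curvature, parameterized by the position vector $\mathbf r=\mathbf r(u^1,u^2)$ on a domain $D\subset\mathbb R^2$, and let $\mathbf n$ be a unit normal vector field of $S$. Let $\mathbf a\in E^3$, $|\mathbf a|=1$, be the constant direction of the incident rays (flat incident front), with $(\mathbf a,\mathbf n)<0$ everywhere on $S$, and put $\cos\theta=(\mathbf a,\mathbf n)$. Then there exist two caustics of the reflected front, and their parametric equations can be given by $$\boldsymbol\xi_i^{*}=\mathbf r+\frac{1}{k_i^{*}}\,\mathbf b\qquad(i=1,2),$$ where $\mathbf b=\mathbf a-2(\mathbf a,\mathbf n)\mathbf n$ is the direction of the reflected rays and $k_1^{*},k_2^{*}$ are the roots (counted with multiplicity) of the equation $$(k^{*})^{2}+2\cos\theta\left(2H+k_n(a_t)\tan^{2}\theta\right)k^{*}+4K=0.$$ Here $H$ is the mean curvature of $S$, $K$ is the Gaussian curvature of $S$, and $k_n(a_t)$ is the normal curvature of $S$ in the direction of the tangential projection $a_t$ of the incident rays.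
   Context: $(\cdot,\cdot)$ is the Euclidean dot product in $E^3$. The first and second fundamental forms of $S$ are $g_{ij}=(\partial_i\mathbf r,\partial_j\mathbf r)$ and $B_{ij}=-(\partial_i\mathbf r,\partial_j\mathbf n)$. The principal curvatures $k_1,k_2$ are the eigenvalues of $B$ relative to $g$, with $2H=k_1+k_2$ and $K=k_1k_2$ (so the unit sphere with inward normal has $k_1=k_2=1$). The tangential projection is $a_t=\mathbf a-(\mathbf a,\mathbf n)\mathbf n$, and $k_n(a_t)=B(a_t,a_t)/g(a_t,a_t)$ where $a_t\ne0$. At points where $a_t=0$ one has $\tan\theta=0$ and the term $k_n(a_t)\tan^2\theta$ is understood as $0$. Only $\cos\theta=(\mathbf a,\mathbf n)$ and $\tan^2\theta=(1-\cos^2\theta)/\cos^2\theta$ enter. The reflected front at time parameter $L$ is $\boldsymbol\rho=\mathbf r+\lambda\mathbf b$ with $\lambda=L-(\mathbf r,\mathbf a)$; it has unit normal field $\mathbf b$. The caustic of the reflected front is its focal set, i.e. the envelope of the family of reflected rays $t\mapsto\mathbf r(u)+t\,\mathbf b(u)$ (extended to full lines, so $t$ may have any sign). Precisely, it is the set of points $\mathbf r(u)+t\,\mathbf b(u)$ at which the differential of the map $(u^1,u^2,t)\mapsto\mathbf r(u^1,u^2)+t\,\mathbf b(u^1,u^2)$ is degenerate. "Two caustics" means the two sheets (counted with multiplicity, possibly coinciding or degenerating to curves or points) corresponding to the two values of $t$ on each reflected ray. *)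

theory Defs
  imports "HOL-Analysis.Analysis" "HOL-Computational_Algebra.Polynomial"
begin

text \<open>Smoothness on an open set: all iterated directional derivatives of every order exist
  (in the sense of Frechet) and are continuous.\<close>

primrec Ck_on :: "nat \<Rightarrow> 'a::real_normed_vector set \<Rightarrow> ('a \<Rightarrow> 'b::real_normed_vector) \<Rightarrow> bool" where
  "Ck_on 0 D f \<longleftrightarrow> continuous_on D f"
| "Ck_on (Suc k) D f \<longleftrightarrow>
     (\<forall>x\<in>D. f differentiable (at x)) \<and> (\<forall>v. Ck_on k D (\<lambda>x. frechet_derivative f (at x) v))"

definition smooth_on :: "'a::real_normed_vector set \<Rightarrow> ('a \<Rightarrow> 'b::real_normed_vector) \<Rightarrow> bool" where
  "smooth_on D f \<longleftrightarrow> (\<forall>k. Ck_on k D f)"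

definition pd :: "2 \<Rightarrow> (real^2 \<Rightarrow> real^3) \<Rightarrow> real^2 \<Rightarrow> real^3" where
  "pd i f u = frechet_derivative f (at u) (axis i 1)"

definition immersion_on :: "(real^2) set \<Rightarrow> (real^2 \<Rightarrow> real^3) \<Rightarrow> bool" where
  "immersion_on D r \<longleftrightarrow> smooth_on D r \<and> (\<forall>u\<in>D. inj (frechet_derivative r (at u)))"

definition unit_normal_field_on ::
    "(real^2) set \<Rightarrow> (real^2 \<Rightarrow> real^3) \<Rightarrow> (real^2 \<Rightarrow> real^3) \<Rightarrow> bool" where
  "unit_normal_field_on D r n \<longleftrightarrow>
     smooth_on D n \<and> (\<forall>u\<in>D. norm (n u) = 1 \<and> (\<forall>i. pd i r u \<bullet> n u = 0))"

definition first_form :: "(real^2 \<Rightarrow> real^3) \<Rightarrow> real^2 \<Rightarrow> real^2^2" where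
  "first_form r u = (\<chi> i j. pd i r u \<bullet> pd j r u)"

definition second_form ::
    "(real^2 \<Rightarrow> real^3) \<Rightarrow> (real^2 \<Rightarrow> real^3) \<Rightarrow> real^2 \<Rightarrow> real^2^2" where
  "second_form r n u = (\<chi> i j. - (pd i r u \<bullet> pd j n u))"

text \<open>The second form is symmetric and the first one positive definite, so the principal
  curvatures are the smallest and the largest eigenvalue of the second form relative to the first:
  if there is only one eigenvalue, it is double.\<close>

definition principal_curvatures ::
    "(real^2 \<Rightarrow> real^3) \<Rightarrow> (real^2 \<Rightarrow> real^3) \<Rightarrow> real^2 \<Rightarrow> real set" where
  "principal_curvatures r n u =
     {k. \<exists>v. v \<noteq> 0 \<and> second_form r n u *v v = k *\<^sub>R (first_form r u *v v)}"

definition mean_curvature ::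
    "(real^2 \<Rightarrow> real^3) \<Rightarrow> (real^2 \<Rightarrow> real^3) \<Rightarrow> real^2 \<Rightarrow> real" where
  "mean_curvature r n u =
     (Min (principal_curvatures r n u) + Max (principal_curvatures r n u)) / 2"

definition gauss_curvature ::
    "(real^2 \<Rightarrow> real^3) \<Rightarrow> (real^2 \<Rightarrow> real^3) \<Rightarrow> real^2 \<Rightarrow> real" where
  "gauss_curvature r n u =
     Min (principal_curvatures r n u) * Max (principal_curvatures r n u)"

text \<open>Components of a vector of the tangent plane in the basis of partial derivatives.\<close>

definition tangent_coords :: "(real^2 \<Rightarrow> real^3) \<Rightarrow> real^2 \<Rightarrow> real^3 \<Rightarrow> real^2" where
  "tangent_coords r u w = (THE c. w = (\<Sum>i\<in>UNIV. c $ i *\<^sub>R pd i r u))"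

text \<open>For the zero vector the quotient below is \<open>0 / 0 = 0\<close>.\<close>

definition normal_curvature ::
    "(real^2 \<Rightarrow> real^3) \<Rightarrow> (real^2 \<Rightarrow> real^3) \<Rightarrow> real^2 \<Rightarrow> real^3 \<Rightarrow> real" where
  "normal_curvature r n u w =
     (let c = tangent_coords r u w
      in (c \<bullet> (second_form r n u *v c)) / (c \<bullet> (first_form r u *v c)))"

definition tangential_projection :: "(real^2 \<Rightarrow> real^3) \<Rightarrow> real^3 \<Rightarrow> real^2 \<Rightarrow> real^3" where
  "tangential_projection n a u = a - (a \<bullet> n u) *\<^sub>R n u"

definition reflected_direction :: "(real^2 \<Rightarrow> real^3) \<Rightarrow> real^3 \<Rightarrow> real^2 \<Rightarrow> real^3" where
  "reflected_direction n a u = a - (2 * (a \<bullet> n u)) *\<^sub>R n u"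

text \<open>The monic quadratic polynomial whose roots are \<open>k\<^sub>1\<^sup>*\<close> and \<open>k\<^sub>2\<^sup>*\<close>
  (coefficients listed from the constant term upwards).\<close>

definition reflected_curvature_poly ::
    "(real^2 \<Rightarrow> real^3) \<Rightarrow> (real^2 \<Rightarrow> real^3) \<Rightarrow> real^3 \<Rightarrow> real^2 \<Rightarrow> real poly" where
  "reflected_curvature_poly r n a u =
     (let cos_theta = a \<bullet> n u;
          tan2_theta = (1 - cos_theta\<^sup>2) / cos_theta\<^sup>2;
          kn = normal_curvature r n u (tangential_projection n a u)
      in [: 4 * gauss_curvature r n u,
            2 * cos_theta * (2 * mean_curvature r n u + kn * tan2_theta),
            1 :])"

definition ray_map ::
    "(real^2 \<Rightarrow> real^3) \<Rightarrow> (real^2 \<Rightarrow> real^3) \<Rightarrow> (real^2) \<times> real \<Rightarrow> real^3" where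
  "ray_map r b = (\<lambda>(u, t). r u + t *\<^sub>R b u)"

text \<open>Between spaces of equal dimension, a linear map is degenerate iff it is not injective.\<close>

definition caustic ::
    "(real^2) set \<Rightarrow> (real^2 \<Rightarrow> real^3) \<Rightarrow> (real^2 \<Rightarrow> real^3) \<Rightarrow> (real^3) set" where
  "caustic D r b =
     {ray_map r b (u, t) | u t. u \<in> D \<and> \<not> inj (frechet_derivative (ray_map r b) (at (u, t)))}"

definition ray_jacobian ::
    "(real^2 \<Rightarrow> real^3) \<Rightarrow> (real^2 \<Rightarrow> real^3) \<Rightarrow> real^2 \<Rightarrow> real \<Rightarrow> real" where
  "ray_jacobian r b u t =
     det (matrix (\<lambda>v::real^3.
       frechet_derivative (ray_map r b) (at (u, t)) (vector [v $ 1, v $ 2], v $ 3)))"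

text \<open>On a fixed ray the Jacobian is a polynomial in \<open>t\<close> of degree at most two; the multiplicity
  of a focal point on the ray is the multiplicity of the corresponding root.\<close>

definition focal_parameters ::
    "(real^2 \<Rightarrow> real^3) \<Rightarrow> (real^2 \<Rightarrow> real^3) \<Rightarrow> real^2 \<Rightarrow> real multiset" where
  "focal_parameters r b u = proots (THE p. \<forall>t. poly p t = ray_jacobian r b u t)"

end

(*
  The reflected rays form a normal congruence, so the differential of the ray map can be studied on
  the plane orthogonal to b. Write g and B for the fundamental forms, c = cos(theta), a_i = (r_i, a)
  and X_i = r_i + t b_i. Since b is a unit vector, (b_i, b) = 0, (r_i, b) = a_i and
  (b_i, r_j) = 2 c B_ij, the product of the Jacobian det(X_1, X_2, b) at t with its value at t = 0 is
  det(g* + 2 t c B), where g*_ij = g_ij - a_i a_j is the metric induced by projection along b.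
  Expanding this determinant with det g* = c^2 det g gives c^2 det g times the reversed quadratic
  1 + 2 c (2 H + k_n tan^2) t + 4 K t^2, so the focal parameters are the reciprocals of the roots.
  The roots are real because g* is positive definite and B is symmetric, the latter by the symmetry
  of second derivatives.
*)
theory Submission
  imports Defs
begin

section \<open>Symmetry of second derivatives\<close>

lemma has_real_derivative_along_line:
  fixes f :: "'a::real_normed_vector \<Rightarrow> real"
  assumes "(f has_derivative f') (at (p + s *\<^sub>R v))"
  shows "((\<lambda>s. f (p + s *\<^sub>R v)) has_real_derivative f' v) (at s)"
proof -
  have "((\<lambda>s. p + s *\<^sub>R v) has_derivative (\<lambda>h. h *\<^sub>R v)) (at s)"
    by (auto intro!: derivative_eq_intros)
  then have "((\<lambda>s. f (p + s *\<^sub>R v)) has_derivative (\<lambda>h. f' (h *\<^sub>R v))) (at s)"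
    using assms by (rule has_derivative_compose[where f = "\<lambda>s. p + s *\<^sub>R v" and g = f])
  moreover have "(\<lambda>h. f' (h *\<^sub>R v)) = (*) (f' v)"
    using has_derivative_linear[OF assms] by (auto simp: linear_cmul)
  ultimately show ?thesis by (simp add: has_field_derivative_def)
qed

text \<open>The mean value theorem is used twice: along \<open>v\<close> for the difference of
  \<open>f\<close> on two parallel segments, then along \<open>w\<close> for the derivative of
  \<open>f\<close> in direction \<open>v\<close>.\<close>

lemma second_difference_mean_value:
  fixes f :: "'a::real_normed_vector \<Rightarrow> real"
  assumes f': "\<And>y. y \<in> ball x e \<Longrightarrow> (f has_derivative f' y) (at y)"
    and f'': "\<And>y. y \<in> ball x e \<Longrightarrow> ((\<lambda>y. f' y v) has_derivative f'' y) (at y)"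
    and h: "0 < h" "h * (norm v + norm w) < e"
  shows "\<exists>\<xi>\<in>ball x e.
    f (x + h *\<^sub>R v + h *\<^sub>R w) - f (x + h *\<^sub>R v) - f (x + h *\<^sub>R w) + f x = h\<^sup>2 * f'' \<xi> w"
proof -
  have in_ball: "x + s *\<^sub>R v + t *\<^sub>R w \<in> ball x e" if "0 \<le> s" "s \<le> h" "0 \<le> t" "t \<le> h" for s t
  proof -
    have "norm (s *\<^sub>R v + t *\<^sub>R w) \<le> s * norm v + t * norm w"
      using that norm_triangle_ineq[of "s *\<^sub>R v" "t *\<^sub>R w"] by simp
    also have "\<dots> \<le> h * norm v + h * norm w"
      using that by (intro add_mono mult_right_mono) auto
    finally show ?thesis
      using h by (simp add: dist_norm norm_minus_commute algebra_simps)
  qed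
  define \<phi> where "\<phi> s = f ((x + h *\<^sub>R w) + s *\<^sub>R v) - f (x + s *\<^sub>R v)" for s
  have "(\<phi> has_real_derivative f' ((x + h *\<^sub>R w) + s *\<^sub>R v) v - f' (x + s *\<^sub>R v) v) (at s)"
    if "0 \<le> s" "s \<le> h" for s
    unfolding \<phi>_def
    using in_ball[of s h] in_ball[of s 0] that h(1)
    by (intro DERIV_diff has_real_derivative_along_line f') (auto simp: ac_simps)
  from MVT2[OF h(1) this] have "\<exists>s>0. s < h \<and> \<phi> h - \<phi> 0 =
      (h - 0) * (f' ((x + h *\<^sub>R w) + s *\<^sub>R v) v - f' (x + s *\<^sub>R v) v)"
    by blast
  then obtain s where s: "0 < s" "s < h"
    and \<phi>: "\<phi> h - \<phi> 0 = h * (f' (x + s *\<^sub>R v + h *\<^sub>R w) v - f' (x + s *\<^sub>R v) v)"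
    by (auto simp: ac_simps)
  have "((\<lambda>t. f' (x + s *\<^sub>R v + t *\<^sub>R w) v) has_real_derivative f'' (x + s *\<^sub>R v + t *\<^sub>R w) w) (at t)"
    if "0 \<le> t" "t \<le> h" for t
    using in_ball[of s t] s that
    by (intro has_real_derivative_along_line[where f = "\<lambda>y. f' y v"] f'') auto
  from MVT2[OF h(1) this] have "\<exists>t>0. t < h \<and>
      f' (x + s *\<^sub>R v + h *\<^sub>R w) v - f' (x + s *\<^sub>R v + 0 *\<^sub>R w) v =
      (h - 0) * f'' (x + s *\<^sub>R v + t *\<^sub>R w) w"
    by blast
  then obtain t where t: "0 < t" "t < h"
    and "f' (x + s *\<^sub>R v + h *\<^sub>R w) v - f' (x + s *\<^sub>R v) v = h * f'' (x + s *\<^sub>R v + t *\<^sub>R w) w"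
    by auto
  with \<phi> have "\<phi> h - \<phi> 0 = h\<^sup>2 * f'' (x + s *\<^sub>R v + t *\<^sub>R w) w"
    by (simp add: power2_eq_square)
  moreover have "\<phi> h - \<phi> 0 =
      f (x + h *\<^sub>R v + h *\<^sub>R w) - f (x + h *\<^sub>R v) - f (x + h *\<^sub>R w) + f x"
    by (simp add: \<phi>_def ac_simps)
  ultimately show ?thesis
    using in_ball[of s t] s t by force
qed

text \<open>The second difference does not change when \<open>v\<close> and \<open>w\<close> are
  exchanged, so the mean values of the two mixed derivatives over a small ball agree. By continuity
  both are close to the values at \<open>x\<close>, which therefore cannot differ.\<close>

lemma second_derivative_symmetric:
  fixes f :: "'a::real_normed_vector \<Rightarrow> real"
  assumes "open D" "x \<in> D"
    and f': "\<And>y. y \<in> D \<Longrightarrow> (f has_derivative f' y) (at y)"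
    and f'': "\<And>y v. y \<in> D \<Longrightarrow> ((\<lambda>y. f' y v) has_derivative f'' v y) (at y)"
    and cont: "\<And>v w. continuous_on D (\<lambda>y. f'' v y w)"
  shows "f'' v x w = f'' w x v"
proof (rule ccontr)
  assume neq: "f'' v x w \<noteq> f'' w x v"
  define \<epsilon> where "\<epsilon> = dist (f'' v x w) (f'' w x v) / 2"
  have "\<epsilon> > 0"
    using neq by (simp add: \<epsilon>_def)
  have near: "\<forall>\<^sub>F y in nhds x. dist (f'' v y w) (f'' v x w) < \<epsilon>" for v w
  proof -
    have "isCont (\<lambda>y. f'' v y w) x"
      using cont[of v w] assms(1,2) continuous_on_eq_continuous_at by blast
    then have "((\<lambda>y. f'' v y w) \<longlongrightarrow> f'' v x w) (nhds x)"
      using tendsto_at_iff_tendsto_nhds[of "\<lambda>y. f'' v y w" x] by (simp add: isCont_def)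
    then show ?thesis
      using \<open>\<epsilon> > 0\<close> by (rule tendstoD)
  qed
  note near[of v w] near[of w v]
  moreover have "\<forall>\<^sub>F y in nhds x. y \<in> D"
    using assms(1,2) by (rule eventually_nhds_in_open)
  ultimately have "\<forall>\<^sub>F y in nhds x. y \<in> D \<and> dist (f'' v y w) (f'' v x w) < \<epsilon> \<and>
      dist (f'' w y v) (f'' w x v) < \<epsilon>"
    by eventually_elim auto
  then obtain e where "e > 0"
    and e: "\<And>y. y \<in> ball x e \<Longrightarrow> y \<in> D \<and> dist (f'' v y w) (f'' v x w) < \<epsilon> \<and>
      dist (f'' w y v) (f'' w x v) < \<epsilon>"
    unfolding eventually_nhds_metric by (auto simp: dist_commute)
  \<comment> \<open>The summand 1 keeps \<open>K\<close> positive even if both directions vanish;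
    \<open>h * K = e / 2\<close> then keeps the parallelogram inside the ball.\<close>
  define K where "K = norm v + norm w + 1"
  define h where "h = e / (2 * K)"
  have "K > 0"
    by (simp add: K_def add_nonneg_pos)
  then have "h > 0" "h * K = e / 2"
    using \<open>e > 0\<close> by (auto simp: h_def)
  then have "h * (norm v + norm w) = e / 2 - h"
    by (simp add: K_def algebra_simps)
  then have h: "h * (norm v + norm w) < e" "h * (norm w + norm v) < e"
    using \<open>e > 0\<close> \<open>h > 0\<close> by (simp_all add: add.commute)
  have mean_value: "\<exists>\<xi>\<in>ball x e.
      f (x + h *\<^sub>R v + h *\<^sub>R w) - f (x + h *\<^sub>R v) - f (x + h *\<^sub>R w) + f x = h\<^sup>2 * f'' v \<xi> w"
    if "h * (norm v + norm w) < e" for v w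
  proof (rule second_difference_mean_value[where f' = f' and f'' = "f'' v"])
    show "(f has_derivative f' y) (at y)" if "y \<in> ball x e" for y
      using f' e[OF that] by blast
    show "((\<lambda>y. f' y v) has_derivative f'' v y) (at y)" if "y \<in> ball x e" for y
      using f'' e[OF that] by blast
  qed fact+
  from mean_value[OF h(1)] obtain \<xi> where \<xi>: "\<xi> \<in> ball x e"
    "f (x + h *\<^sub>R v + h *\<^sub>R w) - f (x + h *\<^sub>R v) - f (x + h *\<^sub>R w) + f x = h\<^sup>2 * f'' v \<xi> w"
    by (rule bexE)
  from mean_value[OF h(2)] obtain \<eta> where \<eta>: "\<eta> \<in> ball x e"
    "f (x + h *\<^sub>R w + h *\<^sub>R v) - f (x + h *\<^sub>R w) - f (x + h *\<^sub>R v) + f x = h\<^sup>2 * f'' w \<eta> v"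
    by (rule bexE)
  have "h\<^sup>2 * f'' v \<xi> w = h\<^sup>2 * f'' w \<eta> v"
    unfolding \<xi>(2)[symmetric] \<eta>(2)[symmetric] by (simp add: ac_simps)
  then have eq: "f'' v \<xi> w = f'' w \<eta> v"
    using \<open>h > 0\<close> by simp
  \<comment> \<open>One number lies within half the distance of both values at \<open>x\<close>,
    which is absurd.\<close>
  have "dist (f'' v \<xi> w) (f'' v x w) < \<epsilon>" "dist (f'' v \<xi> w) (f'' w x v) < \<epsilon>"
    using e[OF \<xi>(1)] e[OF \<eta>(1)] by (simp_all only: eq)
  then have "dist (f'' v x w) (f'' w x v) < dist (f'' v x w) (f'' w x v)"
    unfolding \<epsilon>_def by (rule dist_triangle_half_r)
  then show False by simp
qed

section \<open>Quadratics, root multisets and determinants\<close>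

text \<open>This gives real eigenvalues of a symmetric form relative to a positive one: after
  multiplication by the square of \<open>E\<close> the difference is a square plus a nonnegative
  multiple of a square. It serves both for the principal curvatures, with g, and for the reflected
  ones, with g*.\<close>

lemma symmetric_pencil_discriminant_nonneg:
  fixes E F G L M N :: real
  assumes "E > 0" "E * G - F\<^sup>2 \<ge> 0"
  shows "4 * (E * G - F\<^sup>2) * (L * N - M\<^sup>2) \<le> (E * N + G * L - 2 * F * M)\<^sup>2"
proof -
  have "E\<^sup>2 * ((E * N + G * L - 2 * F * M)\<^sup>2 - 4 * (E * G - F\<^sup>2) * (L * N - M\<^sup>2)) =
      (E * (E * N - G * L) - 2 * F * (E * M - F * L))\<^sup>2 +
      4 * (E * M - F * L)\<^sup>2 * (E * G - F\<^sup>2)"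
    by algebra
  also have "\<dots> \<ge> 0"
    using assms by simp
  finally show ?thesis
    using assms(1) by (simp add: zero_le_mult_iff)
qed

lemma quadratic_eq_product_of_roots:
  fixes E F G :: real
  assumes "E \<noteq> 0" "F\<^sup>2 \<ge> 4 * E * G"
  shows "E * k\<^sup>2 - F * k + G =
    E * (k - (F - sqrt (F\<^sup>2 - 4 * E * G)) / (2 * E)) * (k - (F + sqrt (F\<^sup>2 - 4 * E * G)) / (2 * E))"
proof -
  define s where "s = sqrt (F\<^sup>2 - 4 * E * G)"
  have "s\<^sup>2 = F\<^sup>2 - 4 * E * G"
    using assms by (simp add: s_def)
  moreover have "4 * E * (E * (k - (F - s) / (2 * E)) * (k - (F + s) / (2 * E))) =
      (2 * E * k - (F - s)) * (2 * E * k - (F + s))"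
    using assms(1) by (simp add: divide_simps mult.commute)
  ultimately have "4 * E * (E * k\<^sup>2 - F * k + G) =
      4 * E * (E * (k - (F - s) / (2 * E)) * (k - (F + s) / (2 * E)))"
    by algebra
  then show ?thesis
    using assms(1) by (simp add: s_def)
qed

text \<open>Vieta's formulas with multiplicity. If the multiset is given, \<open>k1\<close> is a
  root, the cofactor has root \<open>- b - k1\<close>, and comparing multisets identifies this with
  \<open>k2\<close>.\<close>

lemma proots_monic_quadratic_iff:
  fixes k1 k2 :: real
  shows "proots [:c, b, 1:] = {#k1, k2#} \<longleftrightarrow> c = k1 * k2 \<and> b = - (k1 + k2)"
proof
  have factor: "proots [:s * t, - (s + t), 1:] = {#s, t#}" for s t :: real
  proof -
    have "proots ([:- s, 1:] * [:- t, 1:]) = {#s, t#}"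
      by (subst proots_mult) auto
    moreover have "[:- s, 1:] * [:- t, 1:] = [:s * t, - (s + t), 1:]"
      by simp
    ultimately show ?thesis
      by (simp only:)
  qed
  show "proots [:c, b, 1:] = {#k1, k2#}" if "c = k1 * k2 \<and> b = - (k1 + k2)"
    using factor[of k1 k2] that by simp
  show "c = k1 * k2 \<and> b = - (k1 + k2)" if k: "proots [:c, b, 1:] = {#k1, k2#}"
  proof -
    have "k1 \<in># proots [:c, b, 1:]"
      using k by simp
    then have "poly [:c, b, 1:] k1 = 0"
      by (subst (asm) set_count_proots) auto
    then have c: "c = - (b + k1) * k1"
      by (simp add: algebra_simps)
    then have "c = k1 * (- b - k1)" "b = - (k1 + (- b - k1))"
      by (auto simp: algebra_simps)
    then have "proots [:c, b, 1:] = {#k1, - b - k1#}"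
      using factor[of k1 "- b - k1"] by (simp only:)
    with k c show ?thesis by auto
  qed
qed

text \<open>The matrix with rows \<open>x\<close>, \<open>y\<close>, \<open>n\<close> has a Gram
  determinant equal to the nonzero quantity in the hypothesis, so it is invertible, and it sends
  \<open>z\<close> to 0.\<close>

lemma eq_zero_if_orthogonal_to_frame:
  fixes x y n z :: "real^3"
  assumes "x \<bullet> n = 0" "y \<bullet> n = 0" "n \<bullet> n = 1" "(x \<bullet> x) * (y \<bullet> y) - (x \<bullet> y)\<^sup>2 \<noteq> 0"
    and "z \<bullet> x = 0" "z \<bullet> y = 0" "z \<bullet> n = 0"
  shows "z = 0"
proof -
  define A :: "real^3^3" where "A = vector [x, y, n]"
  have "A ** transpose A = vector [vector [x \<bullet> x, x \<bullet> y, x \<bullet> n],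
      vector [y \<bullet> x, y \<bullet> y, y \<bullet> n], vector [n \<bullet> x, n \<bullet> y, n \<bullet> n]]"
    by (simp add: A_def vec_eq_iff forall_3 matrix_matrix_mult_def transpose_def inner_vec_def)
  then have "det (A ** transpose A) = (x \<bullet> x) * (y \<bullet> y) - (x \<bullet> y)\<^sup>2"
    using assms(1-3) by (simp add: det_3 inner_commute power2_eq_square)
  then have "det A * det A = (x \<bullet> x) * (y \<bullet> y) - (x \<bullet> y)\<^sup>2"
    by (simp add: det_mul)
  then have "invertible A"
    using assms(4) by (auto simp: invertible_det_nz)
  moreover have "A *v z = 0"
    using assms(5-7)
    by (simp add: A_def vec_eq_iff forall_3 matrix_vector_mult_def inner_vec_def mult.commute)
  ultimately show ?thesis
    by (metis invertible_left_inverse matrix_left_invertible_ker)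
qed

lemma generalized_eigenvalue_iff:
  fixes A B :: "real^2^2"
  shows "(\<exists>v. v \<noteq> 0 \<and> B *v v = k *\<^sub>R (A *v v)) \<longleftrightarrow> det (B - k *\<^sub>R A) = 0"
proof -
  have "B *v v = k *\<^sub>R (A *v v) \<longleftrightarrow> (B - k *\<^sub>R A) *v v = 0" for v
    by (simp add: matrix_vector_mult_diff_rdistrib scaleR_matrix_vector_assoc)
  moreover have "det (B - k *\<^sub>R A) \<noteq> 0 \<longleftrightarrow> (\<forall>v. (B - k *\<^sub>R A) *v v = 0 \<longrightarrow> v = 0)"
    by (simp only: invertible_det_nz[symmetric] invertible_left_inverse
        matrix_left_invertible_ker)
  ultimately show ?thesis by auto
qed

text \<open>This evaluates a product of Jacobians from inner products of their columns
  alone.\<close>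

lemma det_mult_det_eq_det_inner_columns:
  fixes A B :: "real^'n^'n"
  shows "det A * det B = det (\<chi> i j. column i A \<bullet> column j B)"
proof -
  have "transpose A ** B = (\<chi> i j. column i A \<bullet> column j B)"
    by (simp add: vec_eq_iff matrix_matrix_mult_def transpose_def column_def inner_vec_def)
  then show ?thesis
    by (metis det_mul det_transpose)
qed

lemma inj_iff_det_matrix_nonzero:
  fixes f :: "real^'n \<Rightarrow> real^'n"
  assumes "linear f"
  shows "inj f \<longleftrightarrow> det (matrix f) \<noteq> 0"
proof -
  have "(*v) (matrix f) = f"
    using assms by (simp add: fun_eq_iff matrix_vector_mul)
  then show ?thesis
    using matrix_left_invertible_injective[of "matrix f"]
    by (simp add: invertible_det_nz[symmetric] invertible_left_inverse)
qed

text \<open>The source of the reciprocals: a factor 1 - k t is a nonzero multiple of t -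
  1/k.\<close>

lemma proots_one_minus:
  fixes k :: real
  assumes "k \<noteq> 0"
  shows "proots [:1, - k:] = {#1 / k#}"
proof -
  have "[:1, - k:] = smult (- k) [:- (1 / k), 1:]"
    using assms by simp
  then show ?thesis
    using assms by (simp del: smult_pCons)
qed

lemma ray_map_apply: "ray_map r b (u, t) = r u + t *\<^sub>R b u"
  by (simp add: ray_map_def)

section \<open>The surface, its fundamental forms and its curvatures\<close>

locale illuminated_surface =
  fixes D :: "(real^2) set" and r n :: "real^2 \<Rightarrow> real^3" and a :: "real^3"
  assumes open_D: "open D"
    and immersion: "immersion_on D r"
    and normal_field: "unit_normal_field_on D r n"
    and norm_a: "norm a = 1"
    and illuminated: "u \<in> D \<Longrightarrow> a \<bullet> n u < 0"
begin

text \<open>Classical notation: \<open>E\<close>, \<open>F\<close>, \<open>G\<close> are the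
  coefficients of g and \<open>L\<close>, \<open>M\<close>, \<open>N\<close> those of B;
  \<open>p\<close> and \<open>q\<close> are the covariant components of the tangential part of
  \<open>a\<close>, \<open>c\<close> is cos(theta), and \<Delta> is det g.\<close>

abbreviation "E u \<equiv> pd 1 r u \<bullet> pd 1 r u"
abbreviation "F u \<equiv> pd 1 r u \<bullet> pd 2 r u"
abbreviation "G u \<equiv> pd 2 r u \<bullet> pd 2 r u"
abbreviation "L u \<equiv> - (pd 1 r u \<bullet> pd 1 n u)"
abbreviation "M u \<equiv> - (pd 1 r u \<bullet> pd 2 n u)"
abbreviation "N u \<equiv> - (pd 2 r u \<bullet> pd 2 n u)"
abbreviation "p u \<equiv> pd 1 r u \<bullet> a"
abbreviation "q u \<equiv> pd 2 r u \<bullet> a"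
abbreviation "c u \<equiv> a \<bullet> n u"
abbreviation "\<Delta> u \<equiv> E u * G u - (F u)\<^sup>2"

text \<open>The trace of \<open>adj g\<^sup>* B\<close>, i.e. the linear coefficient of \<open>det (g\<^sup>* + x B)\<close> in \<open>x\<close>.\<close>

definition "T u = (E u - (p u)\<^sup>2) * N u + (G u - (q u)\<^sup>2) * L u - 2 * (F u - p u * q u) * M u"

lemma smooth: "smooth_on D r" "smooth_on D n"
  using immersion normal_field by (auto simp: immersion_on_def unit_normal_field_on_def)

lemma has_derivative:
  assumes "u \<in> D"
  shows "(r has_derivative frechet_derivative r (at u)) (at u)"
    and "(n has_derivative frechet_derivative n (at u)) (at u)"
proof -
  have "Ck_on (Suc 0) D r" "Ck_on (Suc 0) D n"
    using smooth unfolding smooth_on_def by blast+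
  then show "(r has_derivative frechet_derivative r (at u)) (at u)"
    "(n has_derivative frechet_derivative n (at u)) (at u)"
    using assms by (auto simp: frechet_derivative_works)
qed

lemma linear_derivative:
  assumes "u \<in> D"
  shows "linear (frechet_derivative r (at u))" "linear (frechet_derivative n (at u))"
  using has_derivative[OF assms] has_derivative_linear by blast+

lemma continuous_on_pd: "continuous_on D (pd i r)" "continuous_on D (pd i n)"
proof -
  have "Ck_on (Suc 0) D r" "Ck_on (Suc 0) D n"
    using smooth unfolding smooth_on_def by blast+
  then show "continuous_on D (pd i r)" "continuous_on D (pd i n)"
    by (simp_all add: pd_def[abs_def])
qed

lemma frechet_derivative_vector:
  assumes "linear (frechet_derivative f (at u))"
  shows "frechet_derivative f (at u) v = v $ 1 *\<^sub>R pd 1 f u + v $ 2 *\<^sub>R pd 2 f u"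
proof -
  have "v = v $ 1 *\<^sub>R axis 1 1 + v $ 2 *\<^sub>R axis 2 1"
    by (simp add: vec_eq_iff forall_2 axis_def)
  then have "frechet_derivative f (at u) v =
      frechet_derivative f (at u) (v $ 1 *\<^sub>R axis 1 1 + v $ 2 *\<^sub>R axis 2 1)"
    by simp
  also have "\<dots> = v $ 1 *\<^sub>R pd 1 f u + v $ 2 *\<^sub>R pd 2 f u"
    using assms by (simp only: linear_add linear_cmul pd_def)
  finally show ?thesis .
qed

lemma normal:
  assumes "u \<in> D"
  shows "pd i r u \<bullet> n u = 0" "n u \<bullet> pd i r u = 0" "n u \<bullet> n u = 1"
  using normal_field assms by (auto simp: unit_normal_field_on_def inner_commute norm_eq_1)

text \<open>Differentiate (n, n) = 1, which holds on an open set.\<close>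

lemma normal_derivative:
  assumes "u \<in> D"
  shows "n u \<bullet> frechet_derivative n (at u) v = 0"
proof -
  have "((\<lambda>u. n u \<bullet> n u) has_derivative
      (\<lambda>v. n u \<bullet> frechet_derivative n (at u) v + frechet_derivative n (at u) v \<bullet> n u)) (at u)"
    using has_derivative(2)[OF assms] by (intro has_derivative_inner)
  moreover have "((\<lambda>u. n u \<bullet> n u) has_derivative (\<lambda>v. 0)) (at u)"
    by (rule has_derivative_transform_within_open[OF has_derivative_const open_D assms])
       (simp add: normal)
  ultimately have "(\<lambda>v. n u \<bullet> frechet_derivative n (at u) v +
      frechet_derivative n (at u) v \<bullet> n u) = (\<lambda>v. 0)"
    by (rule has_derivative_unique)
  from fun_cong[OF this, of v] show ?thesis
    by (simp add: inner_commute)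
qed

text \<open>Differentiating (r_i, n) = 0 gives (r_i, n_j) = -(r_ij, n), and r_ij is symmetric in its
  normal component.\<close>

lemma second_form_symmetric:
  assumes "u \<in> D"
  shows "pd 2 r u \<bullet> pd 1 n u = pd 1 r u \<bullet> pd 2 n u"
proof -
  define f' where "f' y v = frechet_derivative r (at y) v" for y v
  define f'' where "f'' v y w = frechet_derivative (\<lambda>y. f' y v) (at y) w" for v y w
  have Ck: "Ck_on (Suc (Suc 0)) D r"
    using smooth unfolding smooth_on_def by blast
  have f'': "((\<lambda>y. f' y v) has_derivative f'' v y) (at y)" if "y \<in> D" for y v
    unfolding f'_def f''_def using Ck that
    by (subst frechet_derivative_works[symmetric]) simp
  have cont: "continuous_on D (\<lambda>y. f'' v y w)" for v w
    using Ck unfolding f'_def f''_def by simp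
  \<comment> \<open>The normal is frozen at \<open>u\<close>, which reduces the claim to the
    real-valued function \<open>\<lambda>y. r y \<bullet> n u\<close>.\<close>
  have sym: "f'' v u w \<bullet> n u = f'' w u v \<bullet> n u" for v w
  proof (rule second_derivative_symmetric[OF open_D assms,
        where f = "\<lambda>y. r y \<bullet> n u" and f' = "\<lambda>y v. f' y v \<bullet> n u"
          and f'' = "\<lambda>v y w. f'' v y w \<bullet> n u"])
    show "((\<lambda>y. r y \<bullet> n u) has_derivative (\<lambda>v. f' y v \<bullet> n u)) (at y)" if "y \<in> D" for y
      using has_derivative(1)[OF that] unfolding f'_def by (rule has_derivative_inner_left)
    show "((\<lambda>y. f' y v \<bullet> n u) has_derivative (\<lambda>w. f'' v y w \<bullet> n u)) (at y)"
      if "y \<in> D" for y v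
      using f''[OF that] by (rule has_derivative_inner_left)
    show "continuous_on D (\<lambda>y. f'' v y w \<bullet> n u)" for v w
      using cont by (intro continuous_intros)
  qed
  have "f' u v \<bullet> frechet_derivative n (at u) w = - (f'' v u w \<bullet> n u)" for v w
  proof -
    have "((\<lambda>y. f' y v \<bullet> n y) has_derivative
        (\<lambda>w. f' u v \<bullet> frechet_derivative n (at u) w + f'' v u w \<bullet> n u)) (at u)"
      using f''[OF assms] has_derivative(2)[OF assms] by (intro has_derivative_inner)
    moreover have "f' y v \<bullet> n y = 0" if "y \<in> D" for y
      unfolding f'_def using frechet_derivative_vector[OF linear_derivative(1)[OF that]] that
      by (simp add: normal inner_add_left)
    then have "((\<lambda>y. f' y v \<bullet> n y) has_derivative (\<lambda>w. 0)) (at u)"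
      by (intro has_derivative_transform_within_open[OF has_derivative_const open_D assms]) simp
    ultimately have "(\<lambda>w. f' u v \<bullet> frechet_derivative n (at u) w + f'' v u w \<bullet> n u) = (\<lambda>w. 0)"
      by (rule has_derivative_unique)
    then have "f' u v \<bullet> frechet_derivative n (at u) w + f'' v u w \<bullet> n u = 0"
      by (rule fun_cong)
    then show ?thesis by simp
  qed
  then show ?thesis
    using sym by (simp add: pd_def f'_def)
qed

text \<open>The expression is the squared length of dr(v), nonzero because dr is injective.\<close>

lemma first_form_pos:
  fixes v :: "real^2"
  assumes "u \<in> D" "v \<noteq> 0"
  shows "(v $ 1)\<^sup>2 * E u + 2 * v $ 1 * v $ 2 * F u + (v $ 2)\<^sup>2 * G u > 0"
proof -
  let ?w = "v $ 1 *\<^sub>R pd 1 r u + v $ 2 *\<^sub>R pd 2 r u"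
  have "inj (frechet_derivative r (at u))"
    using immersion assms by (auto simp: immersion_on_def)
  then have "frechet_derivative r (at u) v \<noteq> 0"
    using linear_derivative(1)[OF assms(1)] assms(2) linear_injective_0 by blast
  then have "?w \<bullet> ?w > 0"
    using frechet_derivative_vector[OF linear_derivative(1)[OF assms(1)]] by simp
  also have "?w \<bullet> ?w = (v $ 1)\<^sup>2 * E u + 2 * v $ 1 * v $ 2 * F u + (v $ 2)\<^sup>2 * G u"
    by (simp add: inner_add_left inner_add_right inner_commute power2_eq_square)
  finally show ?thesis .
qed

lemma E_pos: "u \<in> D \<Longrightarrow> E u > 0"
  using first_form_pos[of u "axis 1 1"] by (simp add: axis_def vec_eq_iff)

lemma \<Delta>_pos:
  assumes "u \<in> D"
  shows "\<Delta> u > 0"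
proof -
  \<comment> \<open>On this vector the first form takes the value
    \<open>E u * \<Delta> u\<close>.\<close>
  have "vector [- F u, E u] \<noteq> (0 :: real^2)"
    using E_pos[OF assms] by (metis less_irrefl vector_2(2) zero_index)
  from first_form_pos[OF assms this] have "E u * \<Delta> u > 0"
    by (simp add: power2_eq_square algebra_simps)
  then show ?thesis
    using E_pos[OF assms] by (simp add: zero_less_mult_iff)
qed

text \<open>The principal curvatures are the roots of det(B - k g), a quadratic in k with
  nonnegative discriminant, so their sum and product can be read off from its coefficients.\<close>

lemma curvatures:
  assumes "u \<in> D"
  shows "mean_curvature r n u = (E u * N u + G u * L u - 2 * F u * M u) / (2 * \<Delta> u)"
    and "gauss_curvature r n u = (L u * N u - (M u)\<^sup>2) / \<Delta> u"
proof -
  define B where "B = E u * N u + G u * L u - 2 * F u * M u"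
  define C where "C = L u * N u - (M u)\<^sup>2"
  define s where "s = sqrt (B\<^sup>2 - 4 * \<Delta> u * C)"
  have pos: "\<Delta> u > 0"
    by (rule \<Delta>_pos[OF assms])
  have disc: "B\<^sup>2 \<ge> 4 * \<Delta> u * C"
    unfolding B_def C_def
    using E_pos[OF assms] pos by (intro symmetric_pencil_discriminant_nonneg) auto
  then have s: "s \<ge> 0" "s\<^sup>2 = B\<^sup>2 - 4 * \<Delta> u * C"
    by (auto simp: s_def)
  have "det (second_form r n u - k *\<^sub>R first_form r u) = \<Delta> u * k\<^sup>2 - B * k + C" for k
    using second_form_symmetric[OF assms]
    by (simp add: det_2 second_form_def first_form_def B_def C_def inner_commute power2_eq_square algebra_simps)
  then have pc: "principal_curvatures r n u = {(B - s) / (2 * \<Delta> u), (B + s) / (2 * \<Delta> u)}"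
    unfolding principal_curvatures_def generalized_eigenvalue_iff
    using pos disc by (auto simp: quadratic_eq_product_of_roots s_def)
  \<comment> \<open>At an umbilic point \<open>s\<close> is 0 and the set has one element, so
    minimum and maximum both return the double eigenvalue.\<close>
  have extremes: "Min (principal_curvatures r n u) = (B - s) / (2 * \<Delta> u)"
    "Max (principal_curvatures r n u) = (B + s) / (2 * \<Delta> u)"
    unfolding pc using pos s by (auto simp: divide_right_mono min_def max_def divide_le_cancel)
  have quotients: "((x - y) / d + (x + y) / d) / 2 = x / d" "(x - y) / d * ((x + y) / d) = (x\<^sup>2 - y\<^sup>2) / d\<^sup>2"
    for x y d :: real
    by (auto simp: add_divide_distrib diff_divide_distrib power2_eq_square algebra_simps)
  show "mean_curvature r n u = B / (2 * \<Delta> u)"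
    unfolding mean_curvature_def extremes by (rule quotients)
  have K: "gauss_curvature r n u = (B\<^sup>2 - s\<^sup>2) / (2 * \<Delta> u)\<^sup>2"
    unfolding gauss_curvature_def extremes by (rule quotients)
  have quotient: "(B\<^sup>2 - (B\<^sup>2 - 4 * d * C)) / (2 * d)\<^sup>2 = C / d" if "d \<noteq> 0" for d :: real
    using that by (simp add: power2_eq_square)
  show "gauss_curvature r n u = C / \<Delta> u"
    unfolding K s(2) using quotient[of "\<Delta> u"] pos by simp
qed

section \<open>The tangential projection of the incident direction\<close>

text \<open>The contravariant components of a_t: Cramer's rule for the linear system with matrix g
  and right-hand side (\<open>p\<close>, \<open>q\<close>).\<close>

definition "a\<^sub>1 u = (G u * p u - F u * q u) / \<Delta> u"
definition "a\<^sub>2 u = (E u * q u - F u * p u) / \<Delta> u"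

lemma incident_components:
  assumes "u \<in> D"
  shows "p u = E u * a\<^sub>1 u + F u * a\<^sub>2 u" and "q u = F u * a\<^sub>1 u + G u * a\<^sub>2 u"
proof -
  have "p u * \<Delta> u = E u * (G u * p u - F u * q u) + F u * (E u * q u - F u * p u)"
    "q u * \<Delta> u = F u * (G u * p u - F u * q u) + G u * (E u * q u - F u * p u)"
    by algebra+
  then show "p u = E u * a\<^sub>1 u + F u * a\<^sub>2 u" and "q u = F u * a\<^sub>1 u + G u * a\<^sub>2 u"
    using \<Delta>_pos[OF assms] unfolding a\<^sub>1_def a\<^sub>2_def
    by (simp_all only: times_divide_eq_right add_divide_distrib[symmetric]) (simp_all add: eq_divide_eq)
qed

text \<open>Both sides have the same inner products with r_1, r_2 and n, which form a frame.\<close>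

lemma tangential_projection_eq:
  assumes "u \<in> D"
  shows "tangential_projection n a u = a\<^sub>1 u *\<^sub>R pd 1 r u + a\<^sub>2 u *\<^sub>R pd 2 r u"
proof -
  let ?z = "tangential_projection n a u - (a\<^sub>1 u *\<^sub>R pd 1 r u + a\<^sub>2 u *\<^sub>R pd 2 r u)"
  have "?z = 0"
  proof (rule eq_zero_if_orthogonal_to_frame[of "pd 1 r u" "n u" "pd 2 r u"])
    have a: "a \<bullet> pd 1 r u = E u * a\<^sub>1 u + F u * a\<^sub>2 u" "a \<bullet> pd 2 r u = F u * a\<^sub>1 u + G u * a\<^sub>2 u"
      using incident_components[OF assms] by (simp_all add: inner_commute)
    show "?z \<bullet> pd 1 r u = 0"
      by (simp add: tangential_projection_def inner_diff_left inner_add_left normal[OF assms]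
          a(1) inner_commute[of "pd 2 r u"])
    show "?z \<bullet> pd 2 r u = 0"
      by (simp add: tangential_projection_def inner_diff_left inner_add_left normal[OF assms] a(2))
    show "?z \<bullet> n u = 0"
      by (simp add: tangential_projection_def inner_diff_left inner_add_left normal[OF assms])
    show "\<Delta> u \<noteq> 0"
      using \<Delta>_pos[OF assms] by simp
  qed (use normal[OF assms] in simp_all)
  then show ?thesis by simp
qed

text \<open>The squared length of a_t is computed twice: from |a| = 1 and from its
  components.\<close>

lemma sin2_eq:
  assumes "u \<in> D"
  shows "1 - (c u)\<^sup>2 = E u * (a\<^sub>1 u)\<^sup>2 + 2 * F u * a\<^sub>1 u * a\<^sub>2 u + G u * (a\<^sub>2 u)\<^sup>2"
proof -
  have "1 - (c u)\<^sup>2 = tangential_projection n a u \<bullet> tangential_projection n a u"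
    using norm_a
    by (simp add: tangential_projection_def inner_diff_left inner_diff_right normal[OF assms]
        inner_commute[of "n u" a] norm_eq_1 power2_eq_square)
  then show ?thesis
    unfolding tangential_projection_eq[OF assms]
    by (simp add: inner_add_left inner_add_right inner_commute[of "pd 2 r u" "pd 1 r u"]
        power2_eq_square algebra_simps)
qed

lemma tangent_coords_tangential_projection:
  assumes "u \<in> D"
  shows "tangent_coords r u (tangential_projection n a u) = vector [a\<^sub>1 u, a\<^sub>2 u]"
  unfolding tangent_coords_def
proof (rule the_equality)
  show "tangential_projection n a u = (\<Sum>i\<in>UNIV. vector [a\<^sub>1 u, a\<^sub>2 u] $ i *\<^sub>R pd i r u)"
    by (simp add: sum_2 tangential_projection_eq[OF assms])
  fix d :: "real^2"
  assume "tangential_projection n a u = (\<Sum>i\<in>UNIV. d $ i *\<^sub>R pd i r u)"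
  \<comment> \<open>Combinations of the partial derivatives are values of dr, so injectivity of dr
    gives uniqueness of the coordinates.\<close>
  then have "frechet_derivative r (at u) d = frechet_derivative r (at u) (vector [a\<^sub>1 u, a\<^sub>2 u])"
    unfolding frechet_derivative_vector[OF linear_derivative(1)[OF assms]]
    by (simp add: sum_2 tangential_projection_eq[OF assms])
  moreover have "inj (frechet_derivative r (at u))"
    using immersion assms by (auto simp: immersion_on_def)
  ultimately show "d = vector [a\<^sub>1 u, a\<^sub>2 u]"
    by (simp add: inj_eq)
qed

text \<open>This is B(a_t, a_t).\<close>

definition "II u = L u * (a\<^sub>1 u)\<^sup>2 + 2 * M u * a\<^sub>1 u * a\<^sub>2 u + N u * (a\<^sub>2 u)\<^sup>2"

text \<open>Here sin^2 is g(a_t, a_t), the denominator of k_n. The product form survives normal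
  incidence: there a_t = 0, so both sides vanish.\<close>

lemma normal_curvature_times_sin2:
  assumes "u \<in> D"
  shows "normal_curvature r n u (tangential_projection n a u) * (1 - (c u)\<^sup>2) = II u"
proof -
  have "normal_curvature r n u (tangential_projection n a u) = II u / (1 - (c u)\<^sup>2)"
    unfolding sin2_eq[OF assms] normal_curvature_def tangent_coords_tangential_projection[OF assms]
    using second_form_symmetric[OF assms]
    by (simp add: Let_def first_form_def second_form_def matrix_vector_mult_def inner_vec_def sum_2
        II_def inner_commute[of "pd 2 r u" "pd 1 r u"] power2_eq_square algebra_simps)
  moreover have "II u = 0" if "1 - (c u)\<^sup>2 = 0"
  proof -
    have "vector [a\<^sub>1 u, a\<^sub>2 u] = (0 :: real^2)"
      using first_form_pos[OF assms, of "vector [a\<^sub>1 u, a\<^sub>2 u]"] sin2_eq[OF assms] that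
      by (force simp: algebra_simps)
    then have "a\<^sub>1 u = 0" "a\<^sub>2 u = 0"
      by (metis vector_2 zero_index)+
    then show ?thesis by (simp add: II_def)
  qed
  ultimately show ?thesis by auto
qed

text \<open>Since k_n tan^2 = B(a_t, a_t) / cos^2, the linear coefficient is governed by the trace
  \<open>T\<close>, which splits into a mean curvature term and a term in B(a_t, a_t).\<close>

lemma reflected_curvature_poly_eq:
  assumes "u \<in> D"
  shows "reflected_curvature_poly r n a u =
    [: 4 * (L u * N u - (M u)\<^sup>2) / \<Delta> u, 2 * T u / (c u * \<Delta> u), 1 :]"
proof -
  define H where "H = E u * N u + G u * L u - 2 * F u * M u"
  have nz: "\<Delta> u \<noteq> 0" "c u \<noteq> 0"
    using \<Delta>_pos[OF assms] illuminated[OF assms] by auto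
  \<comment> \<open>The splitting of \<open>T\<close> as a polynomial identity, with
    \<open>x\<close>, \<open>y\<close> standing for the components of a_t; the factor
    \<open>1 - (...)\<close> becomes cos^2.\<close>
  have expand: "(e - (e * x + f * y)\<^sup>2) * n + (g - (f * x + g * y)\<^sup>2) * l
        - 2 * (f - (e * x + f * y) * (f * x + g * y)) * m =
      (1 - (e * x\<^sup>2 + 2 * f * x * y + g * y\<^sup>2)) * (e * n + g * l - 2 * f * m)
        + (l * x\<^sup>2 + 2 * m * x * y + n * y\<^sup>2) * (e * g - f\<^sup>2)" for e f g l m n x y :: real
    by (simp add: power2_eq_square algebra_simps)
  have "T u = (1 - (1 - (c u)\<^sup>2)) * H + II u * \<Delta> u"
    unfolding T_def incident_components[OF assms] sin2_eq[OF assms] II_def H_def by (rule expand)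
  then have "T u = (c u)\<^sup>2 * H + II u * \<Delta> u"
    by simp
  moreover have "2 * x * (2 * h / (2 * d) + y / x\<^sup>2) = 2 * (x\<^sup>2 * h + y * d) / (x * d)"
    if "x \<noteq> 0" "d \<noteq> 0" for x y h d :: real
    using that by (simp add: field_simps power2_eq_square)
  ultimately have T: "2 * c u * (2 * H / (2 * \<Delta> u) + II u / (c u)\<^sup>2) = 2 * T u / (c u * \<Delta> u)"
    using nz by (simp only: not_False_eq_True)
  have "2 * c u * (2 * mean_curvature r n u + normal_curvature r n u (tangential_projection n a u) *
      ((1 - (c u)\<^sup>2) / (c u)\<^sup>2)) = 2 * T u / (c u * \<Delta> u)"
    unfolding curvatures[OF assms] times_divide_eq_right normal_curvature_times_sin2[OF assms]
    using T unfolding H_def .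
  then show ?thesis
    by (simp add: reflected_curvature_poly_def Let_def curvatures[OF assms])
qed

section \<open>The ray map and its Jacobian\<close>

abbreviation "b \<equiv> reflected_direction n a"

definition "b' u v = - (2 * (a \<bullet> frechet_derivative n (at u) v)) *\<^sub>R n u
  - (2 * c u) *\<^sub>R frechet_derivative n (at u) v"

lemma b_has_derivative:
  assumes "u \<in> D"
  shows "(b has_derivative b' u) (at u)"
proof -
  have "(b has_derivative (\<lambda>v. 0 - ((2 * c u) *\<^sub>R frechet_derivative n (at u) v
      + (2 * (a \<bullet> frechet_derivative n (at u) v)) *\<^sub>R n u))) (at u)"
    unfolding reflected_direction_def[abs_def]
    by (intro has_derivative_diff has_derivative_const has_derivative_scaleR
        has_derivative_mult_right has_derivative_inner_right has_derivative(2)[OF assms])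
  moreover have "(\<lambda>v. 0 - ((2 * c u) *\<^sub>R frechet_derivative n (at u) v
      + (2 * (a \<bullet> frechet_derivative n (at u) v)) *\<^sub>R n u)) = b' u"
    by (simp add: b'_def fun_eq_iff)
  ultimately show ?thesis by simp
qed

lemma frechet_derivative_ray_map:
  assumes "u \<in> D"
  shows "frechet_derivative (ray_map r b) (at (u, t)) =
    (\<lambda>x. frechet_derivative r (at u) (fst x) + t *\<^sub>R b' u (fst x) + snd x *\<^sub>R b u)"
proof -
  have fst: "(fst has_derivative fst) (at (u, t))" and snd: "(snd has_derivative snd) (at (u, t))"
    by (auto intro!: derivative_eq_intros)
  have "((\<lambda>x. r (fst x)) has_derivative (\<lambda>x. frechet_derivative r (at u) (fst x))) (at (u, t))"
    using has_derivative_compose[OF fst, of r] has_derivative(1)[OF assms] by simp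
  moreover have "((\<lambda>x. b (fst x)) has_derivative (\<lambda>x. b' u (fst x))) (at (u, t))"
    using has_derivative_compose[OF fst, of b] b_has_derivative[OF assms] by simp
  ultimately have "((\<lambda>x. r (fst x) + snd x *\<^sub>R b (fst x)) has_derivative
      (\<lambda>x. frechet_derivative r (at u) (fst x) +
        (snd (u, t) *\<^sub>R b' u (fst x) + snd x *\<^sub>R b (fst (u, t))))) (at (u, t))"
    by (intro has_derivative_add has_derivative_scaleR snd)
  then show ?thesis
    by (subst frechet_derivative_at[symmetric])
       (auto simp: ray_map_def case_prod_unfold add.assoc)
qed

text \<open>The two terms of \<open>b'\<close> cancel against \<open>b\<close>, because (n, b) =
  -cos(theta) and (dn, b) = (dn, a). Against a tangent vector the normal term drops out.\<close>

lemma b'_inner: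
  assumes "u \<in> D"
  shows "b' u v \<bullet> b u = 0"
    and "b' u v \<bullet> pd i r u = - (2 * c u * (pd i r u \<bullet> frechet_derivative n (at u) v))"
  using normal[OF assms] normal_derivative[OF assms, of v]
  by (simp_all add: b'_def reflected_direction_def inner_diff_left inner_diff_right inner_commute)

text \<open>Taking the second factor at parameter 0 avoids the products (b_i, b_j), so all entries
  are at most linear in \<open>t\<close>. The border (\<open>p\<close>, \<open>q\<close>, 1) coming
  from the column \<open>b\<close> turns g into g* in the 2 by 2 determinant.\<close>

lemma ray_jacobian_times:
  assumes "u \<in> D"
  shows "ray_jacobian r b u t * ray_jacobian r b u 0 =
    (E u - (p u)\<^sup>2 + 2 * t * c u * L u) * (G u - (q u)\<^sup>2 + 2 * t * c u * N u) -
    (F u - p u * q u + 2 * t * c u * M u)\<^sup>2"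
proof -
  define A where "A t = matrix (\<lambda>v::real^3.
      frechet_derivative (ray_map r b) (at (u, t)) (vector [v $ 1, v $ 2], v $ 3))" for t
  have e: "vector [1, 0] = (axis 1 1 :: real^2)" "vector [0, 1] = (axis 2 1 :: real^2)"
    "vector [0, 0] = (0 :: real^2)"
    by (auto simp: vec_eq_iff forall_2 axis_def)
  have zero: "frechet_derivative r (at u) 0 = 0" "b' u 0 = 0"
    using linear_derivative[OF assms] by (auto simp: b'_def linear_0)
  have columns: "column 1 (A t) = pd 1 r u + t *\<^sub>R b' u (axis 1 1)"
    "column 2 (A t) = pd 2 r u + t *\<^sub>R b' u (axis 2 1)" "column 3 (A t) = b u" for t
    by (simp_all add: A_def column_def matrix_def vec_eq_iff frechet_derivative_ray_map[OF assms]
        pd_def axis_def[of _ "1::real", where 'b = 3] e zero)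
  have b_inner: "b u \<bullet> pd 1 r u = p u" "b u \<bullet> pd 2 r u = q u"
    "pd 1 r u \<bullet> b u = p u" "pd 2 r u \<bullet> b u = q u" "b u \<bullet> b u = 1"
    using norm_a normal[OF assms]
    by (simp_all add: reflected_direction_def inner_diff_left inner_diff_right norm_eq_1
        inner_commute)
  have b'_pd: "b' u (axis i 1) \<bullet> pd j r u = - (2 * c u * (pd j r u \<bullet> pd i n u))" for i j
    unfolding b'_inner(2)[OF assms] by (simp add: pd_def)
  have "(\<chi> i j. column i (A t) \<bullet> column j (A 0)) =
    vector [vector [E u + 2 * t * c u * L u, F u + 2 * t * c u * M u, p u],
      vector [F u + 2 * t * c u * M u, G u + 2 * t * c u * N u, q u],
      vector [p u, q u, 1]]"
    using second_form_symmetric[OF assms]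
    by (simp add: vec_eq_iff forall_3 columns inner_add_left b'_inner(1)[OF assms] b'_pd b_inner
        inner_commute[of "pd 2 r u" "pd 1 r u"])
  then have "det (A t) * det (A 0) = det (vector [
      vector [E u + 2 * t * c u * L u, F u + 2 * t * c u * M u, p u],
      vector [F u + 2 * t * c u * M u, G u + 2 * t * c u * N u, q u],
      vector [p u, q u, 1]] :: real^3^3)"
    by (simp only: det_mult_det_eq_det_inner_columns)
  then show ?thesis
    by (simp add: ray_jacobian_def A_def[symmetric] det_3 power2_eq_square algebra_simps)
qed

text \<open>The matrix determinant lemma for the rank-one change from g to g*: the factor 1 - g(a_t,
  a_t) is cos^2.\<close>

lemma projected_form_det:
  assumes "u \<in> D"
  shows "(E u - (p u)\<^sup>2) * (G u - (q u)\<^sup>2) - (F u - p u * q u)\<^sup>2 = (c u)\<^sup>2 * \<Delta> u"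
proof -
  have expand: "(e - (e * x + f * y)\<^sup>2) * (g - (f * x + g * y)\<^sup>2) - (f - (e * x + f * y) * (f * x + g * y))\<^sup>2 =
      (1 - (e * x\<^sup>2 + 2 * f * x * y + g * y\<^sup>2)) * (e * g - f\<^sup>2)" for e f g x y :: real
    by (simp add: power2_eq_square algebra_simps)
  have "(E u - (p u)\<^sup>2) * (G u - (q u)\<^sup>2) - (F u - p u * q u)\<^sup>2 = (1 - (1 - (c u)\<^sup>2)) * \<Delta> u"
    unfolding incident_components[OF assms] sin2_eq[OF assms] by (rule expand)
  then show ?thesis by simp
qed

text \<open>The square of this value is det g* > 0, so it may be cancelled below.\<close>

lemma ray_jacobian_0_nonzero:
  assumes "u \<in> D"
  shows "ray_jacobian r b u 0 \<noteq> 0"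
proof
  assume "ray_jacobian r b u 0 = 0"
  then have "(c u)\<^sup>2 * \<Delta> u = 0"
    using ray_jacobian_times[OF assms, of 0] projected_form_det[OF assms] by simp
  then show False
    using \<Delta>_pos[OF assms] illuminated[OF assms] by simp
qed

text \<open>Multiplied by its value at 0, the Jacobian is det(g* + 2 t c B), whose constant term is
  the square of that value; one factor cancels. The coefficients of the curvature polynomial appear
  in reverse order.\<close>

lemma ray_jacobian_eq:
  assumes "u \<in> D" and "reflected_curvature_poly r n a u = [: \<gamma>, \<beta>, 1 :]"
  shows "ray_jacobian r b u t = ray_jacobian r b u 0 * (1 + \<beta> * t + \<gamma> * t\<^sup>2)"
proof -
  let ?J = "ray_jacobian r b u"
  have nz: "\<Delta> u \<noteq> 0" "c u \<noteq> 0"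
    using \<Delta>_pos[OF assms(1)] illuminated[OF assms(1)] by auto
  have "\<gamma> = 4 * (L u * N u - (M u)\<^sup>2) / \<Delta> u" "\<beta> = 2 * T u / (c u * \<Delta> u)"
    using reflected_curvature_poly_eq[OF assms(1)] assms(2) by auto
  then have coeffs: "(c u)\<^sup>2 * \<Delta> u * \<gamma> = 4 * (c u)\<^sup>2 * (L u * N u - (M u)\<^sup>2)"
    "(c u)\<^sup>2 * \<Delta> u * \<beta> = 2 * c u * T u"
    using nz by (simp_all only: times_divide_eq_right) (simp_all add: power2_eq_square)
  have "?J t * ?J 0 = ((E u - (p u)\<^sup>2) * (G u - (q u)\<^sup>2) - (F u - p u * q u)\<^sup>2) +
      2 * c u * T u * t + 4 * (c u)\<^sup>2 * (L u * N u - (M u)\<^sup>2) * t\<^sup>2"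
    unfolding ray_jacobian_times[OF assms(1)] T_def by (simp add: power2_eq_square algebra_simps)
  also have "\<dots> = (c u)\<^sup>2 * \<Delta> u * (1 + \<beta> * t + \<gamma> * t\<^sup>2)"
    unfolding coeffs[symmetric] projected_form_det[OF assms(1)] by (simp only: distrib_left mult.assoc mult_1_right)
  also have "(c u)\<^sup>2 * \<Delta> u = ?J 0 * ?J 0"
    using ray_jacobian_times[OF assms(1), of 0] projected_form_det[OF assms(1)] by simp
  finally have "?J 0 * ?J t = ?J 0 * (?J 0 * (1 + \<beta> * t + \<gamma> * t\<^sup>2))"
    by (simp only: ac_simps)
  then show ?thesis
    using ray_jacobian_0_nonzero[OF assms(1)] by (simp only: mult_cancel_left) simp
qed

lemma degenerate_iff:
  assumes "u \<in> D"
  shows "\<not> inj (frechet_derivative (ray_map r b) (at (u, t))) \<longleftrightarrow> ray_jacobian r b u t = 0"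
proof -
  let ?g = "frechet_derivative (ray_map r b) (at (u, t))"
  let ?e = "\<lambda>v::real^3. (vector [v $ 1, v $ 2] :: real^2, v $ 3)"
  have "linear (b' u)" "linear (frechet_derivative r (at u))"
    using b_has_derivative[OF assms] has_derivative_linear linear_derivative[OF assms] by blast+
  then have "linear ?g"
    unfolding frechet_derivative_ray_map[OF assms]
    by (intro linearI) (simp_all add: linear_add linear_cmul algebra_simps)
  moreover have "linear ?e"
    by (intro linearI) (simp_all add: vec_eq_iff forall_2)
  ultimately have "linear (\<lambda>v. ?g (?e v))"
    using linear_compose[of ?e ?g] by (simp add: o_def)
  then have "inj (\<lambda>v. ?g (?e v)) \<longleftrightarrow> ray_jacobian r b u t \<noteq> 0"
    unfolding ray_jacobian_def by (rule inj_iff_det_matrix_nonzero)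
  \<comment> \<open>Regrouping three coordinates as a pair is a linear bijection, so it carries
    injectivity over to an endomorphism of \<open>real^3\<close>.\<close>
  moreover have "bij ?e"
  proof (rule bij_betw_byWitness[where f' = "\<lambda>x. vector [fst x $ 1, fst x $ 2, snd x]"])
  qed (auto simp: vec_eq_iff forall_2 forall_3)
  then have "inj ?g \<longleftrightarrow> inj (?g \<circ> ?e)"
    using inj_compose[of ?g ?e] inj_on_imageI[of ?g ?e UNIV] by (auto simp: bij_def)
  ultimately show ?thesis
    by (simp add: o_def)
qed

section \<open>Focal parameters and reality of the roots\<close>

text \<open>The reversed quadratic factors as (1 - k1 t)(1 - k2 t). Both roots are nonzero because
  k1 k2 = 4 K, so no focal point of the ray escapes to infinity.\<close>

lemma focal_parameters_eq:
  assumes "u \<in> D" "gauss_curvature r n u \<noteq> 0"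
    and "proots (reflected_curvature_poly r n a u) = {#k1, k2#}"
  shows "k1 \<noteq> 0" "k2 \<noteq> 0"
    and "focal_parameters r b u = {#1 / k1, 1 / k2#}"
    and "ray_jacobian r b u t = 0 \<longleftrightarrow> t = 1 / k1 \<or> t = 1 / k2"
proof -
  obtain \<beta> where poly: "reflected_curvature_poly r n a u = [:4 * gauss_curvature r n u, \<beta>, 1:]"
    unfolding reflected_curvature_poly_def Let_def by blast
  with assms(3) have k: "4 * gauss_curvature r n u = k1 * k2" "\<beta> = - (k1 + k2)"
    by (simp_all add: proots_monic_quadratic_iff)
  then show nz: "k1 \<noteq> 0" "k2 \<noteq> 0"
    using assms(2) by auto
  let ?J = "ray_jacobian r b u"
  have J: "?J t = ?J 0 * ((1 - k1 * t) * (1 - k2 * t))" for t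
    unfolding ray_jacobian_eq[OF assms(1) poly, of t] k
    by (simp add: power2_eq_square algebra_simps)
  have nz0: "?J 0 \<noteq> 0"
    by (rule ray_jacobian_0_nonzero[OF assms(1)])
  have "1 - k * t = 0 \<longleftrightarrow> t = 1 / k" if "k \<noteq> 0" for k
    using that by (auto simp: field_simps)
  then show "?J t = 0 \<longleftrightarrow> t = 1 / k1 \<or> t = 1 / k2"
    unfolding J[of t] mult_eq_0_iff using nz nz0 by simp
  let ?P = "smult (?J 0) ([:1, - k1:] * [:1, - k2:])"
  have "poly ?P t = ?J t" for t
    unfolding J[of t] by (simp add: algebra_simps)
  \<comment> \<open>The description is well defined: real polynomials with equal values everywhere
    are equal.\<close>
  then have "(THE P. \<forall>t. poly P t = ?J t) = ?P"
    by (intro the_equality) (auto simp flip: poly_eq_poly_eq_iff)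
  then have "focal_parameters r b u = proots ?P"
    by (simp only: focal_parameters_def)
  also have "\<dots> = proots [:1, - k1:] + proots [:1, - k2:]"
    using nz0 by (subst proots_smult, simp, subst proots_mult) auto
  finally show "focal_parameters r b u = {#1 / k1, 1 / k2#}"
    using nz by (simp add: proots_one_minus)
qed

text \<open>Ordering the roots by size through the quadratic formula keeps them continuous even
  where they meet. They are real because the discriminant is a positive multiple of that of B
  relative to g*.\<close>

lemma continuous_roots:
  obtains k1 k2 where "continuous_on D k1" "continuous_on D k2"
    "\<And>u. u \<in> D \<Longrightarrow> proots (reflected_curvature_poly r n a u) = {#k1 u, k2 u#}"
proof -
  define \<gamma> where "\<gamma> u = 4 * (L u * N u - (M u)\<^sup>2) / \<Delta> u" for u
  define \<beta> where "\<beta> u = 2 * T u / (c u * \<Delta> u)" for u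
  define s where "s u = sqrt ((\<beta> u)\<^sup>2 - 4 * \<gamma> u)" for u
  have nz: "\<Delta> u \<noteq> 0" "c u \<noteq> 0" if "u \<in> D" for u
    using \<Delta>_pos[OF that] illuminated[OF that] by auto
  have "continuous_on D n"
    using smooth(2) unfolding smooth_on_def by (metis Ck_on.simps(1))
  then have "continuous_on D \<gamma>" "continuous_on D \<beta>"
    unfolding \<gamma>_def \<beta>_def T_def using nz
    by (auto intro!: continuous_intros continuous_on_pd)
  then have cont: "continuous_on D (\<lambda>u. (- \<beta> u - s u) / 2)" "continuous_on D (\<lambda>u. (- \<beta> u + s u) / 2)"
    unfolding s_def by (auto intro!: continuous_intros)
  have "proots (reflected_curvature_poly r n a u) = {#(- \<beta> u - s u) / 2, (- \<beta> u + s u) / 2#}"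
    if u: "u \<in> D" for u
  proof -
    let ?E = "E u - (p u)\<^sup>2" and ?F = "F u - p u * q u" and ?G = "G u - (q u)\<^sup>2"
    have "4 * (?E * ?G - ?F\<^sup>2) * (L u * N u - (M u)\<^sup>2) \<le> (T u)\<^sup>2"
      unfolding T_def
    proof (rule symmetric_pencil_discriminant_nonneg)
      have pos: "?E * ?G - ?F\<^sup>2 > 0"
        unfolding projected_form_det[OF u] using \<Delta>_pos[OF u] nz(2)[OF u] by simp
      then show "?E * ?G - ?F\<^sup>2 \<ge> 0" by simp
      \<comment> \<open>Cauchy-Schwarz gives only a nonstrict sign; were the entry 0, the
        determinant of g* could not be positive.\<close>
      have "(p u)\<^sup>2 \<le> E u"
        using Cauchy_Schwarz_ineq[of "pd 1 r u" a] norm_a by (simp add: norm_eq_1)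
      moreover have "?E \<noteq> 0"
        using pos by auto
      ultimately show "?E > 0" by simp
    qed
    then have T: "4 * ((c u)\<^sup>2 * \<Delta> u) * (L u * N u - (M u)\<^sup>2) \<le> (T u)\<^sup>2"
      unfolding projected_form_det[OF u] .
    have "(\<beta> u)\<^sup>2 - 4 * \<gamma> u =
        4 * ((T u)\<^sup>2 - 4 * ((c u)\<^sup>2 * \<Delta> u) * (L u * N u - (M u)\<^sup>2)) / (c u * \<Delta> u)\<^sup>2"
    proof -
      have "(2 * t / (x * d))\<^sup>2 - 4 * (4 * k / d) = 4 * (t\<^sup>2 - 4 * (x\<^sup>2 * d) * k) / (x * d)\<^sup>2"
        if "x \<noteq> 0" "d \<noteq> 0" for t x d k :: real
        using that by (simp add: field_simps power2_eq_square)
      from this[OF nz(2,1)[OF u]] show ?thesis unfolding \<beta>_def \<gamma>_def .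
    qed
    also have "\<dots> \<ge> 0"
      using T[THEN diff_ge_0_iff_ge[THEN iffD2]]
      by (intro divide_nonneg_nonneg zero_le_power2 mult_nonneg_nonneg[OF zero_le_numeral])
    finally have "(s u)\<^sup>2 = (\<beta> u)\<^sup>2 - 4 * \<gamma> u"
      by (simp add: s_def)
    then have "\<gamma> u = (- \<beta> u - s u) / 2 * ((- \<beta> u + s u) / 2)"
      by (simp add: power2_eq_square algebra_simps)
    then show ?thesis
      unfolding reflected_curvature_poly_eq[OF u] \<beta>_def[symmetric] \<gamma>_def[symmetric]
        proots_monic_quadratic_iff
      by (simp add: field_simps)
  qed
  with cont show thesis by (rule that)
qed

end

section \<open>The two sheets of the caustic\<close>

theorem theorem1p1:
  fixes D :: "(real^2) set" and r n :: "real^2 \<Rightarrow> real^3" and a :: "real^3"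
  assumes "open D" and "connected D" and "D \<noteq> {}"
    and "immersion_on D r"
    and "unit_normal_field_on D r n"
    and "\<forall>u\<in>D. gauss_curvature r n u \<noteq> 0"
    and "norm a = 1"
    and "\<forall>u\<in>D. a \<bullet> n u < 0"
  shows "(\<exists>k1 k2. continuous_on D k1 \<and> continuous_on D k2 \<and>
           (\<forall>u\<in>D. proots (reflected_curvature_poly r n a u) = {#k1 u, k2 u#})) \<and>
         (\<forall>k1 k2. (\<forall>u\<in>D. proots (reflected_curvature_poly r n a u) = {#k1 u, k2 u#}) \<longrightarrow>
           (\<forall>u\<in>D. k1 u \<noteq> 0 \<and> k2 u \<noteq> 0 \<and>
             focal_parameters r (reflected_direction n a) u = {#1 / k1 u, 1 / k2 u#}) \<and>
           caustic D r (reflected_direction n a) =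
             (\<lambda>u. r u + (1 / k1 u) *\<^sub>R reflected_direction n a u) ` D \<union>
             (\<lambda>u. r u + (1 / k2 u) *\<^sub>R reflected_direction n a u) ` D)"
proof -
  interpret illuminated_surface D r n a
    using assms by unfold_locales auto
  show ?thesis
  proof (intro conjI allI impI)
    show "\<exists>k1 k2. continuous_on D k1 \<and> continuous_on D k2 \<and>
        (\<forall>u\<in>D. proots (reflected_curvature_poly r n a u) = {#k1 u, k2 u#})"
      using continuous_roots by metis
    fix k1 k2
    assume "\<forall>u\<in>D. proots (reflected_curvature_poly r n a u) = {#k1 u, k2 u#}"
    then have focal: "k1 u \<noteq> 0" "k2 u \<noteq> 0" "focal_parameters r b u = {#1 / k1 u, 1 / k2 u#}"
      "ray_jacobian r b u t = 0 \<longleftrightarrow> t = 1 / k1 u \<or> t = 1 / k2 u" if "u \<in> D" for u t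
      using focal_parameters_eq[OF that, of "k1 u" "k2 u"] assms(6) that by simp_all
    show "\<forall>u\<in>D. k1 u \<noteq> 0 \<and> k2 u \<noteq> 0 \<and> focal_parameters r b u = {#1 / k1 u, 1 / k2 u#}"
      using focal by simp
    \<comment> \<open>The caustic is determined ray by ray, so any labelling of the two roots,
      continuous or not, yields the same union of sheets.\<close>
    have "caustic D r b = {r u + t *\<^sub>R b u | u t. u \<in> D \<and> (t = 1 / k1 u \<or> t = 1 / k2 u)}"
      unfolding caustic_def by (simp add: ray_map_apply degenerate_iff focal(4) cong: conj_cong)
    also have "\<dots> = (\<lambda>u. r u + (1 / k1 u) *\<^sub>R b u) ` D \<union> (\<lambda>u. r u + (1 / k2 u) *\<^sub>R b u) ` D"
      by (intro set_eqI) (simp add: image_iff, metis)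
    finally show "caustic D r b =
        (\<lambda>u. r u + (1 / k1 u) *\<^sub>R b u) ` D \<union> (\<lambda>u. r u + (1 / k2 u) *\<^sub>R b u) ` D" .
  qed
qed

end
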